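(* Let $n\ge 1$ and $m\ge 2$. The Hamming graph $H(n,m)$ yields a binary even LCD code if and only if $m$ is odd.
   Context: The Hamming graph $H(n,m)$ has as vertices the $n$-tuples over an $m$-element alphabet, two being adjacent when they differ in exactly one coordinate. A binary code of length $N$ is a linear subspace $C\subseteq\mathbb{F}_2^N$ (the zero code is allowed). Its dual $C^\perp$ is taken with respect to $\langle x,y\rangle=\sum_i x_iy_i$. $C$ is LCD (linear complementary dual) if $C\cap C^\perp=\{0\}$, equivalently $\mathbb{F}_2^N=C\oplus C^\perp$. $C$ is even if every codeword has even Hamming weight. For an LCD code $C$, the orthogonal projector $\Pi_C$ is the unique $N\times N$ matrix over $\mathbb{F}_2$ with $v\Pi_C=v$ for all row vectors $v\in C$ and $v\Pi_C=0$ for all $v\in C^\perp$. A finite simple graph on $N$ (ordered) vertices with adjacency matrix $A$ is said to yield a binary even LCD code if $A$, read over $\mathbb{F}_2$, equals $\Pi_C$ for some binary even LCD code $C$ of length $N$; this $C$ (which is the row span of $A$ over $\mathbb{F}_2$) is the code yielded by the graph. *)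

theory Defs
  imports
    "HOL-Library.Z2"
    "Jordan_Normal_Form.VS_Connect"
    "Graph_Theory.Pair_Digraph"
begin

text \<open>A simple graph is a \<^locale>\<open>pair_graph\<close>: a finite, symmetric, loop-free set of pairs.
  The field with two elements is the type \<^typ>\<open>bit\<close>.\<close>

subsection \<open>Graphs\<close>

definition hamming_graph :: "nat \<Rightarrow> 'a set \<Rightarrow> 'a list pair_pre_digraph" where
  "hamming_graph n S =
     (let X = {xs. set xs \<subseteq> S \<and> length xs = n}
      in \<lparr> pverts = X,
           parcs = {(xs, ys). xs \<in> X \<and> ys \<in> X \<and> card {i. i < n \<and> xs ! i \<noteq> ys ! i} = 1} \<rparr>)"

lemma pair_graph_hamming_graph:
  assumes "finite S"
  shows "pair_graph (hamming_graph n S)"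
proof -
  let ?G = "hamming_graph n S"
  have fin: "finite (pverts ?G)"
    using finite_lists_length_eq[OF assms, of n] by (simp add: hamming_graph_def Let_def)
  have sub: "parcs ?G \<subseteq> pverts ?G \<times> pverts ?G"
    by (auto simp: hamming_graph_def Let_def)
  have sym: "(y, x) \<in> parcs ?G" if "(x, y) \<in> parcs ?G" for x y
  proof -
    have "{i. i < n \<and> y ! i \<noteq> x ! i} = {i. i < n \<and> x ! i \<noteq> y ! i}" by auto
    then show ?thesis using that by (simp add: hamming_graph_def Let_def)
  qed
  have loop: "(x, x) \<notin> parcs ?G" for x
    by (simp add: hamming_graph_def Let_def)
  show ?thesis
  proof
    show "finite (parcs ?G)"
      using sub fin by (meson finite_SigmaI finite_subset)
    show "symmetric (with_proj ?G)"
      unfolding symmetric_def with_proj_simps using sym by (auto intro: symI)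
  qed (use fin sub loop in auto)
qed

text \<open>The list \<^term>\<open>vs\<close> fixes the order of the vertices.\<close>

definition adjacency_matrix :: "'v pair_pre_digraph \<Rightarrow> 'v list \<Rightarrow> 'b :: zero_neq_one mat" where
  "adjacency_matrix G vs =
     mat (length vs) (length vs) (\<lambda>(i, j). if (vs ! i, vs ! j) \<in> parcs G then 1 else 0)"

subsection \<open>Binary codes\<close>

definition binary_code :: "nat \<Rightarrow> bit vec set \<Rightarrow> bool" where
  "binary_code N C \<longleftrightarrow> VectorSpace.subspace class_ring C (module_vec TYPE(bit) N)"

abbreviation dual_code :: "nat \<Rightarrow> bit vec set \<Rightarrow> bit vec set" where
  "dual_code \<equiv> vec_module.orthogonal_complement"

definition LCD :: "nat \<Rightarrow> bit vec set \<Rightarrow> bool" where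
  "LCD N C \<longleftrightarrow> C \<inter> dual_code N C = {0\<^sub>v N}"

definition hamming_weight :: "bit vec \<Rightarrow> nat" where
  "hamming_weight x = card {i. i < dim_vec x \<and> x $ i \<noteq> 0}"

definition even_code :: "bit vec set \<Rightarrow> bool" where
  "even_code C \<longleftrightarrow> (\<forall>x\<in>C. even (hamming_weight x))"

definition is_orth_projector :: "nat \<Rightarrow> bit vec set \<Rightarrow> bit mat \<Rightarrow> bool" where
  "is_orth_projector N C P \<longleftrightarrow>
     P \<in> carrier_mat N N \<and>
     (\<forall>v\<in>C. mat_of_row v * P = mat_of_row v) \<and>
     (\<forall>v\<in>dual_code N C. mat_of_row v * P = 0\<^sub>m 1 N)"

text \<open>Such a matrix exists and is unique when \<^term>\<open>C\<close> is an LCD code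
  (\<open>is_orth_projector_ex1\<close> below); otherwise the value is meaningless.\<close>

definition orth_projector :: "nat \<Rightarrow> bit vec set \<Rightarrow> bit mat" where
  "orth_projector N C = (THE P. is_orth_projector N C P)"

definition yields_binary_even_LCD_code :: "'v pair_pre_digraph \<Rightarrow> 'v list \<Rightarrow> bool" where
  "yields_binary_even_LCD_code G vs \<longleftrightarrow>
     (\<exists>C. binary_code (length vs) C \<and> LCD (length vs) C \<and> even_code C \<and>
          adjacency_matrix G vs = orth_projector (length vs) C)"

subsection \<open>Existence and uniqueness of the orthogonal projector\<close>

lemma binary_codeD:
  assumes "binary_code N C"
  shows "C \<subseteq> carrier_vec N" "0\<^sub>v N \<in> C" "\<And>x y. x \<in> C \<Longrightarrow> y \<in> C \<Longrightarrow> x + y \<in> C"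
    "\<And>a x. x \<in> C \<Longrightarrow> a \<cdot>\<^sub>v x \<in> C"
proof -
  have sm: "submodule class_ring C (module_vec TYPE(bit) N)"
    using assms unfolding binary_code_def VectorSpace.subspace_def by blast
  show sub: "C \<subseteq> carrier_vec N"
    using submodule.subset[OF sm] by (simp add: module_vec_simps)
  show add: "\<And>x y. x \<in> C \<Longrightarrow> y \<in> C \<Longrightarrow> x + y \<in> C"
    using submodule.m_closed[OF sm] by (simp add: module_vec_simps)
  show "\<And>a x. x \<in> C \<Longrightarrow> a \<cdot>\<^sub>v x \<in> C"
    using submodule.smult_closed[OF sm] by (simp add: module_vec_simps)
  show "0\<^sub>v N \<in> C"
    using submodule.zero_closed[OF sm] by (simp add: module_vec_simps)
qed

lemma dual_code_iff:
  "x \<in> dual_code N C \<longleftrightarrow> x \<in> carrier_vec N \<and> (\<forall>y\<in>C. x \<bullet> y = 0)"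
  by (simp add: vec_module.orthogonal_complement_def)

lemma bit_add_self [simp]: "(a :: bit) + a = 0"
  by (cases a) simp_all

lemma bit_vec_add_add:
  assumes "x \<in> carrier_vec N" "z \<in> carrier_vec N"
  shows "(x + z) + z = (x :: bit vec)"
  using assms by (intro eq_vecI) (auto simp: add.assoc)

lemma finite_bit_vecs: "finite (carrier_vec N :: bit vec set)"
proof -
  have "finite (UNIV :: bit set)"
  proof -
    have "(UNIV :: bit set) = {0, 1}" by (auto intro: bit.exhaust)
    then show ?thesis by (metis finite.emptyI finite_insert)
  qed
  then have "finite {xs :: bit list. set xs \<subseteq> UNIV \<and> length xs = N}"
    by (rule finite_lists_length_eq)
  moreover have "(carrier_vec N :: bit vec set) \<subseteq>
      vec_of_list ` {xs. set xs \<subseteq> UNIV \<and> length xs = N}"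
  proof
    fix x :: "bit vec" assume "x \<in> carrier_vec N"
    then have "x = vec_of_list (list_of_vec x)" "length (list_of_vec x) = N"
      by (simp_all add: vec_list)
    then show "x \<in> vec_of_list ` {xs. set xs \<subseteq> UNIV \<and> length xs = N}" by blast
  qed
  ultimately show ?thesis by (meson finite_surj)
qed

definition bit_sign :: "bit \<Rightarrow> int" where
  "bit_sign a = (if a = 0 then 1 else - 1)"

lemma bit_sign_add: "bit_sign (a + b) = bit_sign a * bit_sign b"
  by (cases a; cases b) (simp_all add: bit_sign_def)

lemma sum_bit_sign_eq_0:
  assumes C: "binary_code N C"
    and g: "\<And>x y. x \<in> C \<Longrightarrow> y \<in> C \<Longrightarrow> g (x + y) = g x + g y"
    and z: "z \<in> C" "g z \<noteq> 0"
  shows "(\<Sum>x\<in>C. bit_sign (g x)) = 0"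
proof -
  note CD = binary_codeD[OF C]
  have inv: "(x + z) + z = x" if "x \<in> C" for x
    using bit_vec_add_add CD(1) z(1) that by blast
  have "(\<Sum>x\<in>C. bit_sign (g x)) = (\<Sum>x\<in>C. bit_sign (g (x + z)))"
    by (rule sum.reindex_bij_witness[of _ "\<lambda>x. x + z" "\<lambda>x. x + z"])
      (simp_all only: inv CD(3) z(1))
  also have "\<dots> = (\<Sum>x\<in>C. - bit_sign (g x))"
    by (rule sum.cong) (use z in \<open>simp_all add: g bit_sign_add bit_sign_def\<close>)
  finally show ?thesis by (simp add: sum_negf)
qed

lemma LCD_represent:
  assumes C: "binary_code N C" and L: "LCD N C" and v: "v \<in> carrier_vec N"
  shows "\<exists>c\<in>C. \<forall>x\<in>C. x \<bullet> v = x \<bullet> c"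
proof (rule ccontr)
  note CD = binary_codeD[OF C]
  assume "\<not> ?thesis"
  then have nr: "\<And>c. c \<in> C \<Longrightarrow> \<exists>x\<in>C. x \<bullet> v \<noteq> x \<bullet> c" by blast
  have car: "\<And>x. x \<in> C \<Longrightarrow> x \<in> carrier_vec N" using CD(1) by auto
  have fin: "finite C" using CD(1) finite_bit_vecs by (rule finite_subset)
  let ?S = "\<Sum>c\<in>C. \<Sum>x\<in>C. bit_sign (x \<bullet> v + x \<bullet> c)"
  have "?S = 0"
  proof (rule sum.neutral, rule ballI)
    fix c assume c: "c \<in> C"
    from nr[OF c] obtain z where z: "z \<in> C" "z \<bullet> v \<noteq> z \<bullet> c" by blast
    show "(\<Sum>x\<in>C. bit_sign (x \<bullet> v + x \<bullet> c)) = 0"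
    proof (rule sum_bit_sign_eq_0[OF C _ z(1)])
      show "z \<bullet> v + z \<bullet> c \<noteq> 0"
        using z(2) by (cases "z \<bullet> v"; cases "z \<bullet> c") auto
      fix x y assume "x \<in> C" "y \<in> C"
      then show "(x + y) \<bullet> v + (x + y) \<bullet> c = (x \<bullet> v + x \<bullet> c) + (y \<bullet> v + y \<bullet> c)"
        using add_scalar_prod_distrib[OF car car v] add_scalar_prod_distrib[OF car car car[OF c]]
        by (simp only: ac_simps)
    qed
  qed
  moreover have "?S = (\<Sum>x\<in>C. \<Sum>c\<in>C. bit_sign (x \<bullet> v + x \<bullet> c))"
    by (rule sum.swap)
  moreover have "\<dots> = (\<Sum>x\<in>C. if x = 0\<^sub>v N then int (card C) else 0)"
  proof (rule sum.cong[OF refl])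
    fix x assume x: "x \<in> C"
    show "(\<Sum>c\<in>C. bit_sign (x \<bullet> v + x \<bullet> c)) = (if x = 0\<^sub>v N then int (card C) else 0)"
    proof (cases "x = 0\<^sub>v N")
      case True
      have "bit_sign (x \<bullet> v + x \<bullet> c) = 1" if "c \<in> C" for c
        using car[OF that] v True by (simp add: bit_sign_def)
      then show ?thesis using True by simp
    next
      case False
      then have "x \<notin> dual_code N C" using L x by (auto simp: LCD_def)
      then obtain z where z: "z \<in> C" "x \<bullet> z \<noteq> 0"
        using car[OF x] by (auto simp: dual_code_iff)
      have "(\<Sum>c\<in>C. bit_sign (x \<bullet> c)) = 0"
        by (rule sum_bit_sign_eq_0[where g = "\<lambda>c. x \<bullet> c", OF C _ z])
          (rule scalar_prod_add_distrib[OF car[OF x] car car])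
      then show ?thesis
        using False by (simp only: bit_sign_add sum_distrib_left[symmetric]) simp
    qed
  qed
  moreover have "\<dots> = int (card C)"
    using fin CD(2) by (simp add: sum.delta')
  ultimately have "card C = 0" by simp
  then show False using fin CD(2) by auto
qed

lemma mat_of_row_mult_index:
  assumes "v \<in> carrier_vec N" "P \<in> carrier_mat N N" "j < N"
  shows "(mat_of_row v * P) $$ (0, j) = (\<Sum>i<N. v $ i * P $$ (i, j))"
  using assms by (auto simp: scalar_prod_def lessThan_atLeast0 intro!: sum.cong)

lemma is_orth_projector_ex1:
  assumes C: "binary_code N C" and L: "LCD N C"
  shows "\<exists>!P. is_orth_projector N C P"
proof -
  note CD = binary_codeD[OF C]
  have car: "\<And>x. x \<in> C \<Longrightarrow> x \<in> carrier_vec N" using CD(1) by auto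
  have triv: "x = 0\<^sub>v N" if "x \<in> C" "x \<in> dual_code N C" for x
    using L that by (auto simp: LCD_def)
  have "\<forall>i. \<exists>c\<in>C. \<forall>x\<in>C. x \<bullet> unit_vec N i = x \<bullet> c"
    using LCD_represent[OF C L] by simp
  then obtain c where c: "\<And>i. c i \<in> C" "\<And>i x. x \<in> C \<Longrightarrow> x \<bullet> unit_vec N i = x \<bullet> c i"
    by metis
  define w where "w v = vec N (\<lambda>j. \<Sum>i<N. v $ i * c i $ j)" for v :: "bit vec"
  define P where "P = mat N N (\<lambda>(i, j). c i $ j)"
  have wP: "mat_of_row v * P = mat_of_row (w v)" if "v \<in> carrier_vec N" for v
  proof (rule eq_matI)
    fix i j assume "i < dim_row (mat_of_row (w v))" "j < dim_col (mat_of_row (w v))"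
    then have ij: "i = 0" "j < N" by (simp_all add: w_def)
    have P: "P \<in> carrier_mat N N" by (simp add: P_def)
    show "(mat_of_row v * P) $$ (i, j) = mat_of_row (w v) $$ (i, j)"
      unfolding ij(1) mat_of_row_mult_index[OF that P ij(2)] using ij(2) by (simp add: w_def P_def)
  qed (simp_all add: P_def w_def)
  have wC: "w v \<in> C" for v
  proof -
    have "vec N (\<lambda>j. \<Sum>i<k. v $ i * c i $ j) \<in> C" for k
    proof (induction k)
      case 0
      then show ?case using CD(2) by (simp add: zero_vec_def)
    next
      case (Suc k)
      have "vec N (\<lambda>j. \<Sum>i<Suc k. v $ i * c i $ j) =
          vec N (\<lambda>j. \<Sum>i<k. v $ i * c i $ j) + v $ k \<cdot>\<^sub>v c k"
        using car[OF c(1)[of k]] by (intro eq_vecI) auto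
      then show ?case using CD(3)[OF Suc CD(4)[OF c(1)]] by simp
    qed
    then show ?thesis by (simp add: w_def)
  qed
  have dotw: "x \<bullet> w v = x \<bullet> v" if x: "x \<in> C" and v: "v \<in> carrier_vec N" for x v
  proof -
    have "x \<bullet> w v = (\<Sum>j<N. x $ j * (\<Sum>i<N. v $ i * c i $ j))"
      by (simp add: w_def scalar_prod_def lessThan_atLeast0)
    also have "\<dots> = (\<Sum>i<N. v $ i * (\<Sum>j<N. x $ j * c i $ j))"
      unfolding sum_distrib_left by (subst sum.swap) (simp add: ac_simps)
    also have "\<dots> = (\<Sum>i<N. v $ i * (x \<bullet> c i))"
      by (simp only: scalar_prod_def lessThan_atLeast0 carrier_vecD[OF car[OF c(1)]])
    also have "\<dots> = (\<Sum>i<N. v $ i * x $ i)"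
      using car[OF x] by (intro sum.cong) (simp_all add: c(2)[OF x, symmetric])
    also have "\<dots> = x \<bullet> v"
      using v by (simp add: scalar_prod_def lessThan_atLeast0 ac_simps)
    finally show ?thesis .
  qed
  have wcar: "w v \<in> carrier_vec N" for v by (simp add: w_def)
  have diff: "v + w v \<in> dual_code N C" if v: "v \<in> carrier_vec N" for v
  proof -
    have "(v + w v) \<bullet> x = 0" if x: "x \<in> C" for x
    proof -
      have "(v + w v) \<bullet> x = x \<bullet> (v + w v)"
        using v wcar car[OF x] by (intro comm_scalar_prod[of _ N]) auto
      also have "\<dots> = x \<bullet> v + x \<bullet> w v"
        using v wcar car[OF x] by (intro scalar_prod_add_distrib[of _ N]) auto
      finally show ?thesis using dotw[OF x v] by simp
    qed
    then show ?thesis using v wcar by (simp add: dual_code_iff)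
  qed
  have wid: "w v = v" if v: "v \<in> C" for v
  proof -
    have "v + w v = 0\<^sub>v N" by (rule triv[OF CD(3)[OF v wC] diff[OF car[OF v]]])
    then have "(v + w v) + w v = 0\<^sub>v N + w v" by simp
    then show ?thesis using bit_vec_add_add[OF car[OF v] wcar, of v] wcar[of v] by simp
  qed
  have wzero: "w v = 0\<^sub>v N" if v: "v \<in> dual_code N C" for v
  proof (rule triv[OF wC])
    have vc: "v \<in> carrier_vec N" using v by (simp add: dual_code_iff)
    have "w v \<bullet> x = 0" if x: "x \<in> C" for x
    proof -
      have "w v \<bullet> x = x \<bullet> w v" using wcar car[OF x] by (intro comm_scalar_prod[of _ N]) auto
      also have "\<dots> = v \<bullet> x"
        using dotw[OF x vc] comm_scalar_prod[OF vc car[OF x]] by simp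
      finally show ?thesis using v x by (simp add: dual_code_iff)
    qed
    then show "w v \<in> dual_code N C" using wcar by (simp add: dual_code_iff)
  qed
  show ?thesis
  proof (rule ex1I)
    have "mat_of_row (0\<^sub>v N :: bit vec) = 0\<^sub>m 1 N" by (intro eq_matI) auto
    then show P: "is_orth_projector N C P"
      unfolding is_orth_projector_def
      using wP wid wzero car by (auto simp: P_def dual_code_iff)
    fix Q assume Q: "is_orth_projector N C Q"
    have eq: "mat_of_row v * Q = mat_of_row (w v)" if v: "v \<in> carrier_vec N" for v
    proof -
      let ?d = "v + w v"
      have Qc: "Q \<in> carrier_mat N N" using Q by (simp add: is_orth_projector_def)
      have "mat_of_row (x + y) = mat_of_row x + mat_of_row y"
        if "x \<in> carrier_vec N" "y \<in> carrier_vec N" for x y :: "bit vec"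
        using that by (intro eq_matI) (auto simp: mat_of_row_def)
      from this[of ?d "w v"] have "mat_of_row v = mat_of_row ?d + mat_of_row (w v)"
        unfolding bit_vec_add_add[OF v wcar] using v wcar by simp
      then have "mat_of_row v * Q = mat_of_row ?d * Q + mat_of_row (w v) * Q"
        using v wcar Qc by (simp add: add_mult_distrib_mat[of _ 1 N _ _ N])
      also have "\<dots> = 0\<^sub>m 1 N + mat_of_row (w v)"
        using Q diff[OF v] wC by (simp add: is_orth_projector_def)
      also have "\<dots> = mat_of_row (w v)"
        using wcar by (intro left_add_zero_mat) auto
      finally show ?thesis .
    qed
    show "Q = P"
    proof (rule eq_matI)
      have Qc: "Q \<in> carrier_mat N N" using Q by (simp add: is_orth_projector_def)
      have Pc: "P \<in> carrier_mat N N" by (simp add: P_def)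
      show "dim_row Q = dim_row P" "dim_col Q = dim_col P" using Qc Pc by auto
      fix i j assume "i < dim_row P" "j < dim_col P"
      then have ij: "i < N" "j < N" using Pc by auto
      have sel: "(mat_of_row (unit_vec N i) * M) $$ (0, j) = M $$ (i, j)"
        if M: "M \<in> carrier_mat N N" for M :: "bit mat"
      proof -
        have "(\<Sum>k<N. unit_vec N i $ k * M $$ (k, j)) = (\<Sum>k<N. if k = i then M $$ (k, j) else 0)"
          using ij by (intro sum.cong) auto
        also have "\<dots> = M $$ (i, j)"
          using ij by (simp only: sum.delta finite_lessThan lessThan_iff if_True)
        finally show ?thesis
          by (simp only: mat_of_row_mult_index[OF unit_vec_carrier M ij(2)])
      qed
      show "Q $$ (i, j) = P $$ (i, j)"
        using sel[OF Qc] sel[OF Pc] eq[OF unit_vec_carrier] wP[OF unit_vec_carrier] by simp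
    qed
  qed
qed

lemma orth_projector_eq_iff:
  assumes "binary_code N C" "LCD N C"
  shows "P = orth_projector N C \<longleftrightarrow> is_orth_projector N C P"
  using is_orth_projector_ex1[OF assms] unfolding orth_projector_def
  by (metis (no_types, lifting) theI')

end

theory Submission
  imports Defs
begin

text \<open>A symmetric matrix \<open>A\<close> over the two-element field with zero diagonal is the orthogonal projector
  of some even LCD code if and only if \<open>A\<^sup>2 = A\<close>; the code is then the set of fixed vectors of \<open>A\<close>,
  and evenness holds because \<open>v \<bullet> A v\<close> vanishes when \<open>A\<close> is alternating.  The
  adjacency matrix of \<open>H(n + 1, m)\<close> is \<open>K \<otimes> I + I \<otimes> A\<close>, where \<open>K\<close> and \<open>A\<close> belong to \<open>H(1, m)\<close>
  and \<open>H(n, m)\<close>.  Its square is \<open>K\<^sup>2 \<otimes> I + I \<otimes> A\<^sup>2\<close> in characteristic two, so everything reduces to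
  the complete graph, where \<open>K\<^sup>2\<close> has the entries \<open>m - 1\<close> and \<open>m - 2\<close>.\<close>

text \<open>These rules turn sums and products into Boolean operations, out of reach of the ring rules.\<close>

lemmas [simp del] = add_bit_eq_xor mult_bit_eq_and

subsection \<open>Alternating idempotent matrices over the two-element field\<close>

lemma of_nat_bit: "(of_nat k :: bit) = of_bool (odd k)"
  by (induction k) auto

text \<open>In characteristic two the terms at \<open>(i, j)\<close> and \<open>(j, i)\<close>
  cancel, which leaves only the zero diagonal.\<close>

lemma sum_symmetric_bit:
  fixes f :: "nat \<Rightarrow> nat \<Rightarrow> bit"
  assumes "\<And>i j. i < N \<Longrightarrow> j < N \<Longrightarrow> f i j = f j i" "\<And>i. i < N \<Longrightarrow> f i i = 0"
  shows "(\<Sum>i<N. \<Sum>j<N. f i j) = 0"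
  using assms
proof (induction N)
  case (Suc N)
  have "(\<Sum>i<N. f i N) = (\<Sum>j<N. f N j)"
    using Suc.prems by (intro sum.cong) auto
  then show ?case
    using Suc by (simp add: sum.distrib add.assoc)
qed simp

text \<open>Squaring fixes both elements of the field, so each nonzero coordinate contributes 1.
  This turns evenness of a code into \<open>v \<bullet> v = 0\<close>.\<close>

lemma scalar_prod_self_bit:
  fixes v :: "bit vec"
  shows "v \<bullet> v = of_nat (hamming_weight v)"
proof -
  have "v \<bullet> v = (\<Sum>i<dim_vec v. if v $ i \<noteq> 0 then 1 else 0)"
    unfolding scalar_prod_def lessThan_atLeast0 by (intro sum.cong) auto
  also have "\<dots> = of_nat (card ({..<dim_vec v} \<inter> {i. v $ i \<noteq> 0}))"
    by (simp add: sum.If_cases)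
  also have "{..<dim_vec v} \<inter> {i. v $ i \<noteq> 0} = {i. i < dim_vec v \<and> v $ i \<noteq> 0}"
    by auto
  finally show ?thesis by (simp add: hamming_weight_def)
qed

section \<open>Symmetric matrices as orthogonal projectors\<close>

lemma mat_of_row_mult:
  fixes v :: "'b :: comm_semiring_0 vec"
  assumes "v \<in> carrier_vec N" "A \<in> carrier_mat N N"
  shows "mat_of_row v * A = mat_of_row (transpose_mat A *\<^sub>v v)"
  using assms by (intro eq_matI) (auto simp: scalar_prod_def intro!: sum.cong simp: mult.commute)

lemma mat_of_row_inject: "mat_of_row v = mat_of_row w \<longleftrightarrow> v = w"
  by (metis row_mat_of_row)

lemma mat_of_row_zero: "mat_of_row (0\<^sub>v N) = 0\<^sub>m 1 N"
  by (intro eq_matI) auto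

text \<open>Projectors are defined by their action on row vectors; for symmetric \<open>A\<close>
  the transpose in \<open>mat_of_row_mult\<close> disappears, and the conditions concern column
  vectors.\<close>

lemma is_orth_projector_symmetric_iff:
  assumes "A \<in> carrier_mat N N" "transpose_mat A = A" "C \<subseteq> carrier_vec N"
  shows "is_orth_projector N C A \<longleftrightarrow>
    (\<forall>v\<in>C. A *\<^sub>v v = v) \<and> (\<forall>v\<in>dual_code N C. A *\<^sub>v v = 0\<^sub>v N)"
proof -
  have "mat_of_row v * A = mat_of_row (A *\<^sub>v v)" if "v \<in> carrier_vec N" for v
    using mat_of_row_mult[OF that assms(1)] assms(2) by simp
  then show ?thesis
    using assms(1,3) unfolding is_orth_projector_def mat_of_row_zero[symmetric]
    by (auto simp: dual_code_iff mat_of_row_inject subset_iff)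
qed

lemma scalar_prod_mult_symmetric_mat:
  fixes A :: "'b :: comm_semiring_0 mat"
  assumes "A \<in> carrier_mat N N" "transpose_mat A = A"
    and "v \<in> carrier_vec N" "w \<in> carrier_vec N"
  shows "v \<bullet> (A *\<^sub>v w) = (A *\<^sub>v v) \<bullet> w"
  using transpose_vec_mult_scalar[OF assms(1,4,3)] assms(2) by metis

lemma scalar_prod_alternating:
  fixes A :: "bit mat"
  assumes A: "A \<in> carrier_mat N N" "transpose_mat A = A" "\<And>i. i < N \<Longrightarrow> A $$ (i, i) = 0"
    and v: "v \<in> carrier_vec N"
  shows "v \<bullet> (A *\<^sub>v v) = 0"
proof -
  have "v \<bullet> (A *\<^sub>v v) = (\<Sum>i<N. \<Sum>j<N. v $ i * (A $$ (i, j) * v $ j))"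
    using A(1) v by (simp add: scalar_prod_def lessThan_atLeast0 sum_distrib_left)
  also have "\<dots> = 0"
  proof (rule sum_symmetric_bit)
    fix i j assume "i < N" "j < N"
    then have "A $$ (i, j) = A $$ (j, i)"
      using A(1) index_transpose_mat(1)[of j A i] unfolding A(2) by auto
    then show "v $ i * (A $$ (i, j) * v $ j) = v $ j * (A $$ (j, i) * v $ i)"
      by (simp only: ac_simps)
  qed (simp add: A(3))
  finally show ?thesis .
qed

text \<open>On \<open>C\<close> the matrix is the identity and on the dual code it vanishes, so
  splitting \<open>v\<close> along \<open>C\<close> and its dual shows that a second application of
  \<open>A\<close> changes nothing.\<close>

lemma orth_projector_idempotent:
  assumes C: "binary_code N C" "LCD N C" and P: "is_orth_projector N C A"
    and sym: "transpose_mat A = A"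
  shows "A * A = A"
proof -
  note CD = binary_codeD[OF C(1)]
  have A: "A \<in> carrier_mat N N" using P by (simp add: is_orth_projector_def)
  note P' = P[unfolded is_orth_projector_symmetric_iff[OF A sym CD(1)]]
  have AA: "A *\<^sub>v (A *\<^sub>v v) = A *\<^sub>v v" if v: "v \<in> carrier_vec N" for v
  proof -
    \<comment> \<open>\<open>c\<close> is the component of \<open>v\<close> in \<open>C\<close>:
      equal products with all of \<open>C\<close> put \<open>v + c\<close>, which is
      \<open>v - c\<close> in characteristic two, into the dual code.\<close>
    obtain c where c: "c \<in> C" "\<And>x. x \<in> C \<Longrightarrow> x \<bullet> v = x \<bullet> c"
      using LCD_represent[OF C v] by blast
    have cc: "c \<in> carrier_vec N" using c(1) CD(1) by blast
    have "(v + c) \<bullet> x = 0" if x: "x \<in> C" for x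
    proof -
      have xc: "x \<in> carrier_vec N" using x CD(1) by blast
      have "(v + c) \<bullet> x = x \<bullet> v + x \<bullet> c"
        using add_scalar_prod_distrib[OF v cc xc] comm_scalar_prod[OF v xc]
          comm_scalar_prod[OF cc xc] by simp
      then show ?thesis using c(2)[OF x] by simp
    qed
    then have "v + c \<in> dual_code N C" using v cc by (simp add: dual_code_iff)
    then have "A *\<^sub>v (v + c) = 0\<^sub>v N" using P' by blast
    moreover have "v = (v + c) + c" using bit_vec_add_add[OF v cc] by simp
    ultimately have "A *\<^sub>v v = A *\<^sub>v c"
      using A v cc mult_add_distrib_mat_vec[OF A, of "v + c" c]
      by (metis add_carrier_vec left_zero_vec mult_mat_vec_carrier)
    then show ?thesis using P' c(1) by simp
  qed
  show ?thesis
  proof (rule mat_col_eqI)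
    fix j assume "j < dim_col A"
    then have j: "j < N" using A by simp
    have cA: "col A j \<in> carrier_vec N" using A j by auto
    have "A *\<^sub>v unit_vec N j = col A j"
      using A j by (intro eq_vecI) auto
    then have "A *\<^sub>v col A j = col A j"
      using AA[of "unit_vec N j"] by simp
    then show "col (A * A) j = col A j"
      using col_mult2[OF A A j] by simp
  qed (use A in auto)
qed

lemma ex_even_LCD_code_iff_idempotent:
  assumes A: "A \<in> carrier_mat N N" "transpose_mat A = A" "\<And>i. i < N \<Longrightarrow> A $$ (i, i) = 0"
  shows "(\<exists>C. binary_code N C \<and> LCD N C \<and> even_code C \<and> A = orth_projector N C)
    \<longleftrightarrow> A * A = A"
proof
  assume "\<exists>C. binary_code N C \<and> LCD N C \<and> even_code C \<and> A = orth_projector N C"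
  then show "A * A = A"
    using orth_projector_eq_iff orth_projector_idempotent A(2) by blast
next
  assume idem: "A * A = A"
  define C where "C = {v \<in> carrier_vec N. A *\<^sub>v v = v}"
  have sub: "C \<subseteq> carrier_vec N" by (auto simp: C_def)
  have code: "binary_code N C"
    unfolding binary_code_def VectorSpace.subspace_def
  proof
    show "vectorspace class_ring (module_vec TYPE(bit) N)"
      by (rule vec_vs)
    show "submodule class_ring C (module_vec TYPE(bit) N)"
      unfolding submodule_def
      using vec_module A(1)
      by (auto simp: C_def module_vec_simps mult_add_distrib_mat_vec mult_mat_vec)
  qed
  have AC: "A *\<^sub>v v \<in> C" if "v \<in> carrier_vec N" for v
    using A(1) that idem by (auto simp: C_def assoc_mult_mat_vec[symmetric])
  \<comment> \<open>Symmetry moves \<open>A\<close> to the other factor \<open>w\<close>, and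
    \<open>A *\<^sub>v w\<close> lies in \<open>C\<close> by idempotence, so
    \<open>A *\<^sub>v v\<close> is orthogonal to every \<open>w\<close> and hence zero.\<close>
  have dual0: "A *\<^sub>v v = 0\<^sub>v N" if v: "v \<in> dual_code N C" for v
  proof -
    have vc: "v \<in> carrier_vec N" using v by (simp add: dual_code_iff)
    have "(A *\<^sub>v v) \<bullet> w = 0" if w: "w \<in> carrier_vec N" for w
      using scalar_prod_mult_symmetric_mat[OF A(1,2) vc w] AC[OF w] v
      by (simp add: dual_code_iff)
    then have "(A *\<^sub>v v) $ i = 0" if "i < N" for i
      using scalar_prod_right_unit[OF that] by (metis unit_vec_carrier)
    then show ?thesis
      using A(1) by (intro eq_vecI) auto
  qed
  \<comment> \<open>A common vector is both fixed and annihilated by \<open>A\<close>.\<close>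
  have "C \<inter> dual_code N C = {0\<^sub>v N}"
    using dual0 A(1) by (auto simp: C_def dual_code_iff)
  then have LCD: "LCD N C" by (simp add: LCD_def)
  have "even_code C"
    unfolding even_code_def
  proof
    fix v assume v: "v \<in> C"
    then have "v \<bullet> v = 0"
      using scalar_prod_alternating[OF A, of v] by (simp add: C_def)
    then show "even (hamming_weight v)"
      by (simp add: scalar_prod_self_bit of_nat_bit)
  qed
  moreover have "is_orth_projector N C A"
    using is_orth_projector_symmetric_iff[OF A(1,2) sub] dual0 by (auto simp: C_def)
  ultimately show "\<exists>C. binary_code N C \<and> LCD N C \<and> even_code C \<and> A = orth_projector N C"
    using code LCD orth_projector_eq_iff[OF code LCD] by blast
qed

text \<open>Entries of the squared adjacency matrix count common neighbours modulo two. Reindexing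
  along \<open>(!) vs\<close> removes the vertex order and leaves a condition on pairs of
  vertices.\<close>

lemma yields_binary_even_LCD_code_iff:
  assumes G: "pair_graph G" and vs: "distinct vs" "set vs = pverts G"
  shows "yields_binary_even_LCD_code G vs \<longleftrightarrow>
    (\<forall>x\<in>pverts G. \<forall>y\<in>pverts G.
      (\<Sum>z\<in>pverts G. of_bool ((x, z) \<in> parcs G) * of_bool ((z, y) \<in> parcs G)) =
      (of_bool ((x, y) \<in> parcs G) :: bit))"
proof -
  interpret pair_graph G by (rule G)
  define N where "N = length vs"
  define A where "A = (adjacency_matrix G vs :: bit mat)"
  have A: "A \<in> carrier_mat N N"
    by (simp add: A_def N_def adjacency_matrix_def)
  have entry: "A $$ (i, j) = of_bool ((vs ! i, vs ! j) \<in> parcs G)" if "i < N" "j < N" for i j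
    using that by (simp add: A_def N_def adjacency_matrix_def)
  have sym: "(x, y) \<in> parcs G \<longleftrightarrow> (y, x) \<in> parcs G" for x y
    using arcs_symmetric by blast
  have tr: "transpose_mat A = A"
    using A by (intro eq_matI) (auto simp: entry sym)
  have diag: "A $$ (i, i) = 0" if "i < N" for i
    using no_loops'[of "vs ! i" "vs ! i"] by (auto simp: entry that)
  have bij: "bij_betw ((!) vs) {..<N} (pverts G)"
    using vs by (intro bij_betw_nth) (auto simp: N_def)
  have square: "(A * A) $$ (i, j) = (\<Sum>z\<in>pverts G.
      of_bool ((vs ! i, z) \<in> parcs G) * of_bool ((z, vs ! j) \<in> parcs G))"
    if ij: "i < N" "j < N" for i j
  proof -
    have "(A * A) $$ (i, j) = (\<Sum>k<N. A $$ (i, k) * A $$ (k, j))"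
      using A ij by (simp add: scalar_prod_def lessThan_atLeast0)
    also have "\<dots> = (\<Sum>k<N. of_bool ((vs ! i, vs ! k) \<in> parcs G) * of_bool ((vs ! k, vs ! j) \<in> parcs G))"
      using ij by (intro sum.cong) (auto simp: entry)
    also have "\<dots> = (\<Sum>z\<in>pverts G. of_bool ((vs ! i, z) \<in> parcs G) * of_bool ((z, vs ! j) \<in> parcs G))"
      by (rule sum.reindex_bij_betw[OF bij])
    finally show ?thesis .
  qed
  have "yields_binary_even_LCD_code G vs \<longleftrightarrow> A * A = A"
    unfolding yields_binary_even_LCD_code_def
    using ex_even_LCD_code_iff_idempotent[OF A tr diag] by (simp add: A_def N_def)
  also have "\<dots> \<longleftrightarrow> (\<forall>i<N. \<forall>j<N. (A * A) $$ (i, j) = A $$ (i, j))"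
    using A by (auto simp del: index_mult_mat(1) intro!: eq_matI)
  also have "\<dots> \<longleftrightarrow> (\<forall>x\<in>(!) vs ` {..<N}. \<forall>y\<in>(!) vs ` {..<N}.
      (\<Sum>z\<in>pverts G. of_bool ((x, z) \<in> parcs G) * of_bool ((z, y) \<in> parcs G)) =
      (of_bool ((x, y) \<in> parcs G) :: bit))"
    unfolding ball_simps by (simp add: square entry Ball_def del: sum_mult_of_bool_eq sum_of_bool_eq)
  finally show ?thesis
    unfolding bij_betw_imp_surj_on[OF bij] .
qed

subsection \<open>Hamming graphs\<close>

text \<open>An adjacency matrix entry with the number of coordinates read off \<open>xs\<close>, so
  that inductions can change it. It is meant for words of equal length.\<close>

definition hamming_adj :: "'a list \<Rightarrow> 'a list \<Rightarrow> bit" where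
  "hamming_adj xs ys = of_bool (card {i. i < length xs \<and> xs ! i \<noteq> ys ! i} = 1)"

definition words :: "'a set \<Rightarrow> nat \<Rightarrow> 'a list set" where
  "words S n = {xs. set xs \<subseteq> S \<and> length xs = n}"

text \<open>The \<open>(xs, ys)\<close> entry of the squared adjacency matrix over the two-element
  field.\<close>

definition common_neighbours_parity :: "'a set \<Rightarrow> nat \<Rightarrow> 'a list \<Rightarrow> 'a list \<Rightarrow> bit" where
  "common_neighbours_parity S n xs ys = (\<Sum>zs\<in>words S n. hamming_adj xs zs * hamming_adj zs ys)"

lemma finite_words: "finite S \<Longrightarrow> finite (words S n)"
  unfolding words_def by (rule finite_lists_length_eq)

lemma words_Suc: "words S (Suc n) = (\<lambda>(z, zs). z # zs) ` (S \<times> words S n)"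
  by (auto simp: words_def length_Suc_conv image_iff)

text \<open>Entry form of \<open>I \<otimes> A + K \<otimes> I\<close>: a single difference lies
  either in the tails, with equal heads, or in the heads, with equal tails. These cases exclude each
  other, so addition modulo two acts as a disjunction.\<close>

lemma hamming_adj_Cons:
  assumes "length xs = length ys"
  shows "hamming_adj (x # xs) (y # ys) =
    of_bool (x = y) * hamming_adj xs ys + of_bool (xs = ys) * of_bool (x \<noteq> y)"
proof -
  let ?D = "{i. i < length xs \<and> xs ! i \<noteq> ys ! i}"
  have "{i. i < length (x # xs) \<and> (x # xs) ! i \<noteq> (y # ys) ! i} =
      (if x = y then {} else {0}) \<union> Suc ` ?D"
    by (auto simp: nth_Cons' image_iff less_Suc_eq_0_disj split: if_splits)
  moreover have "card (Suc ` ?D) = card ?D"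
    by (simp add: card_image)
  moreover have "?D = {} \<longleftrightarrow> xs = ys"
    using assms by (auto simp: list_eq_iff_nth_eq)
  moreover have "card (insert 0 (Suc ` ?D)) = Suc (card (Suc ` ?D))"
    by (rule card_insert_disjoint) auto
  ultimately show ?thesis
    by (auto simp: hamming_adj_def)
qed

lemma sum_complete_graph_bit:
  assumes "finite S" "x \<in> S" "y \<in> S"
  shows "(\<Sum>z\<in>S. of_bool (x \<noteq> z) * of_bool (z \<noteq> y)) =
    (of_bool (if x = y then even (card S) else odd (card S)) :: bit)"
proof -
  have "(\<Sum>z\<in>S. of_bool (x \<noteq> z) * of_bool (z \<noteq> y)) = (\<Sum>z\<in>S. if z \<in> {x, y} then 0 else 1 :: bit)"
    by (intro sum.cong) auto
  also have "\<dots> = of_nat (card (S - {x, y}))"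
    using assms by (simp add: sum.If_cases Diff_eq Compl_eq conj_commute)
  finally have sum: "(\<Sum>z\<in>S. of_bool (x \<noteq> z) * of_bool (z \<noteq> y)) =
    (of_nat (card (S - {x, y})) :: bit)" .
  \<comment> \<open>\<open>{x, y}\<close> has one element or two, so removing it flips the parity
    exactly when \<open>x = y\<close>.\<close>
  have "card (S - {x, y}) + card {x, y} = card S"
    using assms card_Diff_subset[of "{x, y}" S] card_mono[of S "{x, y}"] by simp
  then have "odd (card (S - {x, y})) \<longleftrightarrow> (if x = y then even (card S) else odd (card S))"
    by (cases "x = y") (auto, presburger+)
  then show ?thesis unfolding sum of_nat_bit by simp
qed

text \<open>The mixed terms \<open>2 (K \<otimes> A)\<close> of the square vanish in characteristic two.\<close>

lemma common_neighbours_parity_Cons: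
  assumes "finite S" "x \<in> S" "y \<in> S" "xs \<in> words S n" "ys \<in> words S n"
  shows "common_neighbours_parity S (Suc n) (x # xs) (y # ys) =
    of_bool (x = y) * common_neighbours_parity S n xs ys +
    of_bool (xs = ys) * of_bool (if x = y then even (card S) else odd (card S))"
proof -
  note fin = finite_words[OF assms(1), of n]
  let ?h = hamming_adj
  have inj: "inj_on (\<lambda>(z, zs). z # zs) (S \<times> words S n)"
    by (auto simp: inj_on_def)
  have len: "length zs = n" if "zs \<in> words S n" for zs
    using that by (simp add: words_def)
  have "common_neighbours_parity S (Suc n) (x # xs) (y # ys) =
      (\<Sum>z\<in>S. \<Sum>zs\<in>words S n. ?h (x # xs) (z # zs) * ?h (z # zs) (y # ys))"
    unfolding common_neighbours_parity_def words_Suc sum.reindex[OF inj]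
    by (simp add: sum.cartesian_product case_prod_unfold)
  also have "\<dots> = (\<Sum>z\<in>S. \<Sum>zs\<in>words S n.
      (of_bool (x = z) * ?h xs zs + of_bool (xs = zs) * of_bool (x \<noteq> z)) *
      (of_bool (z = y) * ?h zs ys + of_bool (zs = ys) * of_bool (z \<noteq> y)))"
    using assms len by (intro sum.cong refl) (simp add: hamming_adj_Cons)
  \<comment> \<open>Multiplying out and summing over \<open>zs\<close> yields, in order, the
    contributions to \<open>I \<otimes> A^2\<close>, to the two copies of
    \<open>K \<otimes> A\<close>, and to \<open>K^2 \<otimes> I\<close>.\<close>
  also have "\<dots> = (\<Sum>z\<in>S. of_bool (x = z) * of_bool (z = y) * common_neighbours_parity S n xs ys
      + of_bool (x = z) * of_bool (z \<noteq> y) * ?h xs ys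
      + of_bool (x \<noteq> z) * of_bool (z = y) * ?h xs ys
      + of_bool (xs = ys) * (of_bool (x \<noteq> z) * of_bool (z \<noteq> y)))"
  proof (intro sum.cong refl)
    fix z
    have d1: "(\<Sum>zs\<in>words S n. of_bool (xs = zs) * g zs) = (g xs :: bit)" for g
      using fin assms by (simp add: of_bool_def if_distrib[of "\<lambda>c. c * _"] sum.delta cong: if_cong)
    have d2: "(\<Sum>zs\<in>words S n. of_bool (zs = ys) * g zs) = (g ys :: bit)" for g
      using fin assms by (simp add: of_bool_def if_distrib[of "\<lambda>c. c * _"] sum.delta cong: if_cong)
    let ?a = "of_bool (x = z) :: bit" and ?b = "of_bool (z = y) :: bit"
      and ?a' = "of_bool (x \<noteq> z) :: bit" and ?b' = "of_bool (z \<noteq> y) :: bit"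
    have "(\<Sum>zs\<in>words S n. (?a * ?h xs zs + of_bool (xs = zs) * ?a') *
          (?b * ?h zs ys + of_bool (zs = ys) * ?b')) =
        (\<Sum>zs\<in>words S n. ?a * ?b * (?h xs zs * ?h zs ys)
          + of_bool (zs = ys) * (?a * ?b' * ?h xs zs)
          + of_bool (xs = zs) * (?a' * ?b * ?h zs ys)
          + of_bool (xs = zs) * (of_bool (zs = ys) * (?a' * ?b')))"
      by (intro sum.cong refl) (simp only: algebra_simps)
    also have "\<dots> = ?a * ?b * common_neighbours_parity S n xs ys + ?a * ?b' * ?h xs ys + ?a' * ?b * ?h xs ys
        + of_bool (xs = ys) * (?a' * ?b')"
      by (simp only: sum.distrib d1 d2 common_neighbours_parity_def sum_distrib_left)
    finally show "(\<Sum>zs\<in>words S n. (?a * ?h xs zs + of_bool (xs = zs) * ?a') *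
          (?b * ?h zs ys + of_bool (zs = ys) * ?b')) = \<dots>" .
  qed
  \<comment> \<open>In the first three summands an equation fixes \<open>z\<close>, so the other
    test on \<open>z\<close> becomes a test between \<open>x\<close> and \<open>y\<close>, and one
    indicator times a constant remains.\<close>
  also have "\<dots> = (\<Sum>z\<in>S. of_bool (x = z) * (of_bool (x = y) * common_neighbours_parity S n xs ys)
      + of_bool (x = z) * (of_bool (x \<noteq> y) * ?h xs ys)
      + of_bool (z = y) * (of_bool (x \<noteq> y) * ?h xs ys)
      + of_bool (xs = ys) * (of_bool (x \<noteq> z) * of_bool (z \<noteq> y)))"
    by (intro sum.cong refl) auto
  also have "\<dots> = of_bool (x = y) * common_neighbours_parity S n xs ys
      + (of_bool (x \<noteq> y) * ?h xs ys + of_bool (x \<noteq> y) * ?h xs ys)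
      + of_bool (xs = ys) * (\<Sum>z\<in>S. of_bool (x \<noteq> z) * of_bool (z \<noteq> y))"
  proof -
    have "(\<Sum>z\<in>S. of_bool (x = z) * c) = (c :: bit)" "(\<Sum>z\<in>S. of_bool (z = y) * c) = c" for c
      using assms by (simp_all add: of_bool_def if_distrib[of "\<lambda>c. c * _"] sum.delta cong: if_cong)
    then show ?thesis
      by (simp only: sum.distrib sum_distrib_left add.assoc)
  qed
  finally show ?thesis
    by (simp only: bit_add_self add_0_right sum_complete_graph_bit[OF assms(1-3)])
qed

lemma common_neighbours_parity_eq_hamming_adj:
  assumes "finite S" "odd (card S)" "xs \<in> words S n" "ys \<in> words S n"
  shows "common_neighbours_parity S n xs ys = hamming_adj xs ys"
  using assms(3,4)
proof (induction n arbitrary: xs ys)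
  \<comment> \<open>The only word is the empty one, which is not adjacent to itself, so both sides
    vanish.\<close>
  case 0
  then show ?case by (simp add: common_neighbours_parity_def words_def hamming_adj_def)
next
  case (Suc n)
  then obtain x xs' y ys' where eq: "xs = x # xs'" "ys = y # ys'"
    and mem: "x \<in> S" "y \<in> S" "xs' \<in> words S n" "ys' \<in> words S n"
    unfolding words_Suc by auto
  then have "length xs' = length ys'" by (simp add: words_def)
  \<comment> \<open>For odd \<open>card S\<close> the complete graph satisfies
    \<open>K^2 = K\<close> modulo two, so the recursions for the square and for the adjacency entry
    coincide.\<close>
  then show ?case
    using assms(1,2) mem
    by (simp add: eq common_neighbours_parity_Cons Suc.IH hamming_adj_Cons)
qed

text \<open>One pair decides: two words differing only in their heads are adjacent and have
  \<open>card S - 2\<close> common neighbours, so equality forces this number to be odd.\<close>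

lemma odd_card_if_common_neighbours_parity_eq_hamming_adj:
  assumes "finite S" "card S \<ge> 2"
    and "\<And>xs ys. xs \<in> words S (Suc n) \<Longrightarrow> ys \<in> words S (Suc n) \<Longrightarrow>
      common_neighbours_parity S (Suc n) xs ys = hamming_adj xs ys"
  shows "odd (card S)"
proof -
  obtain x y where xy: "x \<in> S" "y \<in> S" "x \<noteq> y"
    using assms(2) by (metis card_2_iff' card_le_Suc0_iff_eq assms(1) not_less_eq_eq numeral_2_eq_2)
  \<comment> \<open>Any common tail would do; a constant word exists for every length.\<close>
  define xs where "xs = replicate n x"
  have xs: "xs \<in> words S n" using xy by (auto simp: xs_def words_def)
  have "common_neighbours_parity S (Suc n) (x # xs) (y # xs) = hamming_adj (x # xs) (y # xs)"
    using xs xy by (intro assms(3)) (auto simp: words_def)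
  then show ?thesis
    using xy xs assms(1) by (simp add: common_neighbours_parity_Cons hamming_adj_Cons)
qed

theorem proposition4p6:
  fixes n m :: nat and S :: "'a set" and vs :: "'a list list"
  assumes "n \<ge> 1" and "m \<ge> 2" and "card S = m"
    and "distinct vs" and "set vs = pverts (hamming_graph n S)"
  shows "yields_binary_even_LCD_code (hamming_graph n S) vs \<longleftrightarrow> odd m"
proof -
  \<comment> \<open>An infinite set has cardinality 0, so \<open>m \<ge> 2\<close> implies
    finiteness.\<close>
  have fin: "finite S" using assms(2,3) by (intro card_ge_0_finite) simp
  let ?G = "hamming_graph n S"
  have verts: "pverts ?G = words S n"
    by (simp add: hamming_graph_def words_def)
  have arcs: "of_bool ((xs, ys) \<in> parcs ?G) = hamming_adj xs ys"
    if "xs \<in> words S n" "ys \<in> words S n" for xs ys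
    using that by (simp add: hamming_graph_def words_def hamming_adj_def)
  have "(\<Sum>zs\<in>words S n. of_bool ((xs, zs) \<in> parcs ?G) * of_bool ((zs, ys) \<in> parcs ?G)) =
      common_neighbours_parity S n xs ys" if "xs \<in> words S n" "ys \<in> words S n" for xs ys
    unfolding common_neighbours_parity_def by (intro sum.cong refl) (simp add: arcs that)
  then have "yields_binary_even_LCD_code ?G vs \<longleftrightarrow>
      (\<forall>xs\<in>words S n. \<forall>ys\<in>words S n. common_neighbours_parity S n xs ys = hamming_adj xs ys)"
    unfolding yields_binary_even_LCD_code_iff[OF pair_graph_hamming_graph[OF fin] assms(4,5)] verts
    by (simp add: arcs)
  also have "\<dots> \<longleftrightarrow> odd m"
  proof -
    \<comment> \<open>A coordinate is required: for \<open>n = 0\<close> the graph is one isolated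
      vertex, and its zero matrix is idempotent for every \<open>m\<close>.\<close>
    obtain k where "n = Suc k" using assms(1) by (cases n) auto
    then show ?thesis
      using odd_card_if_common_neighbours_parity_eq_hamming_adj[OF fin, of k] common_neighbours_parity_eq_hamming_adj[OF fin] assms(2,3)
      by blast
  qed
  finally show ?thesis .
qed

end
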